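(* Let $\theta$ be a parameter with values in $\Theta$, let $x$ be observed data, let $p(\cdot\mid x)$ denote the posterior distribution of $\theta$ (with posterior density $p(\theta\mid x)$), and let $r$ be a reference density on $\Theta$. Define $s(\theta\mid x)=p(\theta\mid x)/r(\theta)$, for $H\subseteq\Theta$ the tangent set $T(H)=\{\theta_1\in\Theta: \forall\theta_0\in H,\ s(\theta_1\mid x)>s(\theta_0\mid x)\}$, and $\mathrm{ev}(H\mid x)=1-p(T(H)\mid x)$. Let $c\in(0,1)$ with $c<0.5$, and consider the Generalized Full Bayesian Significance Test (GFBST) with cutoff $c$: for a hypothesis $H\subseteq\Theta$ with complement $\widetilde H=\Theta-H$, it rejects $H$ ($\lnot\Diamond H$) if $\mathrm{ev}(H\mid x)\le c$; otherwise it accepts $H$ ($\square H$) if $\mathrm{ev}(\widetilde H\mid x)\le c$; otherwise it leaves $H$ undecided ($\nabla H$); and $\Diamond H$ means $H$ is not rejected. Then $$\square H \Rightarrow p(H\mid x)\ge 1-c \Rightarrow p(H\mid x)>c \Rightarrow \Diamond H.$$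
   Context: All sets involved are assumed measurable so that the posterior probabilities are defined. *)

theory Defs
  imports "HOL-Probability.Probability"
begin

text \<open>
  The parameter space \<open>\<Theta>\<close> is the space of a dominating measure \<open>\<nu>\<close>. The function \<open>p\<close> gives the
  posterior density \<open>p x \<theta>\<close> of \<open>\<theta>\<close> given the data \<open>x\<close>, and \<open>r\<close> the reference density, both with
  respect to \<open>\<nu>\<close>.
\<close>

definition posterior :: "'t measure \<Rightarrow> ('x \<Rightarrow> 't \<Rightarrow> real) \<Rightarrow> 'x \<Rightarrow> 't measure" where
  "posterior \<nu> p x = density \<nu> (\<lambda>\<theta>. ennreal (p x \<theta>))"

definition post_prob :: "'t measure \<Rightarrow> ('x \<Rightarrow> 't \<Rightarrow> real) \<Rightarrow> 'x \<Rightarrow> 't set \<Rightarrow> real" where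
  "post_prob \<nu> p x A = measure (posterior \<nu> p x) A"

text \<open>
  The quotient is taken in \<^typ>\<open>ennreal\<close>, so that it needs no positivity assumption on \<open>r\<close>:
  where \<open>r\<close> is positive it is the ordinary quotient, where \<open>r\<close> vanishes it is infinite if
  the posterior density is positive and \<open>0\<close> otherwise.
\<close>

definition surprise :: "('x \<Rightarrow> 't \<Rightarrow> real) \<Rightarrow> ('t \<Rightarrow> real) \<Rightarrow> 'x \<Rightarrow> 't \<Rightarrow> ennreal" where
  "surprise p r x \<theta> = ennreal (p x \<theta>) / ennreal (r \<theta>)"

definition tangent_set ::
  "'t measure \<Rightarrow> ('x \<Rightarrow> 't \<Rightarrow> real) \<Rightarrow> ('t \<Rightarrow> real) \<Rightarrow> 'x \<Rightarrow> 't set \<Rightarrow> 't set" where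
  "tangent_set \<nu> p r x H =
     {\<theta>1 \<in> space \<nu>. \<forall>\<theta>0\<in>H. surprise p r x \<theta>1 > surprise p r x \<theta>0}"

definition ev ::
  "'t measure \<Rightarrow> ('x \<Rightarrow> 't \<Rightarrow> real) \<Rightarrow> ('t \<Rightarrow> real) \<Rightarrow> 'x \<Rightarrow> 't set \<Rightarrow> real" where
  "ev \<nu> p r x H = 1 - post_prob \<nu> p x (tangent_set \<nu> p r x H)"

datatype decision = Reject | Accept | Undecided

definition gfbst ::
  "'t measure \<Rightarrow> ('x \<Rightarrow> 't \<Rightarrow> real) \<Rightarrow> ('t \<Rightarrow> real) \<Rightarrow> real \<Rightarrow> 'x \<Rightarrow> 't set \<Rightarrow> decision" where
  "gfbst \<nu> p r c x H =
     (if ev \<nu> p r x H \<le> c then Reject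
      else if ev \<nu> p r x (space \<nu> - H) \<le> c then Accept
      else Undecided)"

definition accepts ::
  "'t measure \<Rightarrow> ('x \<Rightarrow> 't \<Rightarrow> real) \<Rightarrow> ('t \<Rightarrow> real) \<Rightarrow> real \<Rightarrow> 'x \<Rightarrow> 't set \<Rightarrow> bool" where
  "accepts \<nu> p r c x H \<longleftrightarrow> gfbst \<nu> p r c x H = Accept"

definition not_rejects ::
  "'t measure \<Rightarrow> ('x \<Rightarrow> 't \<Rightarrow> real) \<Rightarrow> ('t \<Rightarrow> real) \<Rightarrow> real \<Rightarrow> 'x \<Rightarrow> 't set \<Rightarrow> bool" where
  "not_rejects \<nu> p r c x H \<longleftrightarrow> gfbst \<nu> p r c x H \<noteq> Reject"

end

theory Submission imports Defs begin

text \<open>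
  Since the defining inequality of the tangent set is strict, \<open>T(H)\<close> is disjoint from \<open>H\<close>, whence
  \<open>p(H | x) \<le> ev(H | x)\<close>. Applied to \<open>H\<close> this shows that a rejected hypothesis has posterior
  probability at most \<open>c\<close>; applied to the complement, that an accepted one has at least \<open>1 - c\<close>.
\<close>

lemma tangent_set_subset: "tangent_set \<nu> p r x H \<subseteq> space \<nu> - H"
  by (auto simp: tangent_set_def)

lemma post_prob_compl:
  assumes "prob_space (posterior \<nu> p x)" and "H \<in> sets \<nu>"
  shows "post_prob \<nu> p x (space \<nu> - H) = 1 - post_prob \<nu> p x H"
  using prob_space.prob_compl[OF assms(1), of H] assms(2)
  by (simp add: post_prob_def posterior_def)

text \<open>Passing to complements turns \<open>tangent_set_subset\<close> into a bound on
  \<open>ev\<close>; used below for \<open>H\<close> and for its complement.\<close>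

lemma post_prob_le_ev:
  assumes "prob_space (posterior \<nu> p x)" and "H \<in> sets \<nu>"
  shows "post_prob \<nu> p x H \<le> ev \<nu> p r x H"
proof -
  interpret prob_space "posterior \<nu> p x" by fact
  have "post_prob \<nu> p x (tangent_set \<nu> p r x H) \<le> post_prob \<nu> p x (space \<nu> - H)"
    unfolding post_prob_def
    \<comment> \<open>The side condition is measurability of the larger set, the complement of
      \<open>H\<close>; \<open>density\<close> keeps the measurable sets of
      \<open>\<nu>\<close>.\<close>
    by (rule finite_measure_mono[OF tangent_set_subset])
      (use assms(2) in \<open>simp add: posterior_def\<close>)
  then show ?thesis
    using post_prob_compl[OF assms] by (simp add: ev_def)
qed

theorem theorem2:
  fixes \<nu> :: "'t measure" and p :: "'x \<Rightarrow> 't \<Rightarrow> real" and r :: "'t \<Rightarrow> real"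
    and x :: 'x and H :: "'t set" and c :: real
  assumes "p x \<in> borel_measurable \<nu>" and "\<And>\<theta>. \<theta> \<in> space \<nu> \<Longrightarrow> 0 \<le> p x \<theta>"
    and "prob_space (posterior \<nu> p x)"
    and "r \<in> borel_measurable \<nu>" and "\<And>\<theta>. \<theta> \<in> space \<nu> \<Longrightarrow> 0 \<le> r \<theta>"
    and "0 < c" and "c < 1" and "c < 1 / 2"
    and "H \<in> sets \<nu>"
    and "tangent_set \<nu> p r x H \<in> sets \<nu>"
    and "tangent_set \<nu> p r x (space \<nu> - H) \<in> sets \<nu>"
  shows "(accepts \<nu> p r c x H \<longrightarrow> post_prob \<nu> p x H \<ge> 1 - c) \<and>
         (post_prob \<nu> p x H \<ge> 1 - c \<longrightarrow> post_prob \<nu> p x H > c) \<and>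
         (post_prob \<nu> p x H > c \<longrightarrow> not_rejects \<nu> p r c x H)"
proof (intro conjI impI)
  assume "accepts \<nu> p r c x H"
  \<comment> \<open>The value \<open>Accept\<close> arises only in the branch whose test concerns
    the complement of \<open>H\<close>.\<close>
  then have "ev \<nu> p r x (space \<nu> - H) \<le> c"
    by (simp add: accepts_def gfbst_def split: if_splits)
  moreover have "post_prob \<nu> p x (space \<nu> - H) \<le> ev \<nu> p r x (space \<nu> - H)"
    using assms(3,9) by (intro post_prob_le_ev) auto
  ultimately show "post_prob \<nu> p x H \<ge> 1 - c"
    using post_prob_compl[OF assms(3,9)] by simp
next
  assume "post_prob \<nu> p x H \<ge> 1 - c"
  \<comment> \<open>Here \<open>c < 1 / 2\<close> enters, as
    \<open>1 - c > 1 / 2 > c\<close>.\<close>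
  then show "post_prob \<nu> p x H > c"
    using \<open>c < 1 / 2\<close> by simp
next
  assume "post_prob \<nu> p x H > c"
  \<comment> \<open>This strict bound makes the first test of \<open>gfbst\<close> fail, which
    excludes \<open>Reject\<close>.\<close>
  then have "ev \<nu> p r x H > c"
    using post_prob_le_ev[OF assms(3,9)] by (rule less_le_trans)
  then show "not_rejects \<nu> p r c x H"
    by (simp add: not_rejects_def gfbst_def)
qed

end
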